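(* The extended Rubio de Francia basis $\mathcal{R}^\ast$ does not differentiate $L^\infty(\mathbb{T}^\omega)$. That is, there exists $f\in L^\infty(\mathbb{T}^\omega)$ for which it is not true that $\overline{D}\bigl(\int\! f,x\bigr)=\underline{D}\bigl(\int\! f,x\bigr)=f(x)$ for almost every $x\in\mathbb{T}^\omega$, where the upper and lower derivatives are taken with respect to $\mathcal{R}^\ast$.
   Context: $\mathbb{T}=\mathbb{R}/\mathbb{Z}$ is identified with $[0,1)$. $\mathbb{T}^\omega$ is the compact abelian group given by the product of countably infinitely many copies of $\mathbb{T}$, with the product topology and coordinatewise addition mod 1. $m$ (or $dx$) is its Haar measure normalized by $m(\mathbb{T}^\omega)=1$, i.e. the product of the Lebesgue measures. For $n\in\mathbb{N}=\{1,2,\dots\}$ write $\mathbb{T}^\omega=\mathbb{T}^n\times\mathbb{T}^{n,\omega}$, where $\mathbb{T}^{n,\omega}$ is the copy of the infinite torus with coordinates $x_{n+1},x_{n+2},\dots$. The metric is $d(x,y)=\sum_{n=1}^\infty |x_n-y_n|/2^n$, and $\delta(S)=\sup_{x,y\in S}d(x,y)$ is the diameter of $S\subset\mathbb{T}^\omega$. Define open sets $V_m$, $m\in\mathbb{N}$, by $V_1=(0,\frac12)\times\mathbb{T}^{1,\omega}$ and, for $n\ge1$ and $1\le j\le 2n+1$, $V_{n^2+j}=\widetilde V_{n^2+j}\times\mathbb{T}^{n+1,\omega}$, where $\widetilde V_{n^2+j}=(0,\frac1{2^n})^n\times(0,\frac1{2^j})$ if $1\le j\le n$, and $\widetilde V_{n^2+j}=(0,\frac1{2^{n+1}})^{j-n}\times(0,\frac1{2^n})^{2n+1-j}$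 if $n+1\le j\le 2n+1$. (In particular $V_{n^2}=(0,\frac1{2^n})^n\times\mathbb{T}^{n,\omega}$.) Let $\mathcal{R}=\{y+V_m\colon m\in\mathbb{N},\ y\in\mathbb{T}^\omega\}$. For $m\ge2$ and $1\le r\le m$ let $W_{m,r}=\prod_{j=1}^m(0,\ell_j)\times\mathbb{T}^{m,\omega}$ with $\ell_r=2/2^m$ and $\ell_j=1/2^m$ for $j\ne r$ (a "double $(m,m)$-cube"). The extended Rubio de Francia basis is $$\mathcal{R}^\ast=\mathcal{R}\cup\{y+W_{m,r}\colon y\in\mathbb{T}^\omega,\ m\in\mathbb{N},\ m\ge2,\ 1\le r\le m\}.$$ Differentiation: let $\mathcal{B}$ be a family of measurable sets of positive measure. For $x\in\mathbb{T}^\omega$ let $\mathcal{B}(x)$ be the collection of sets in $\mathcal{B}$ whose topological closures contain $x$. For a sequence $\{B_n\}\subset\mathcal{B}(x)$, write $B_n\Rightarrow x$ if $\delta(B_n)\to0$. With $f_B=\frac1{m(B)}\int_B f\,dm$, for real-valued $f\in L^1(\mathbb{T}^\omega)$ put $$\overline{D}\bigl(\textstyle\int\! f,x\bigr)=\sup_{B_n\Rightarrow x}\ \limsup_n f_{B_n},\qquad \underline{D}\bigl(\textstyle\int\! f,x\bigr)=\inf_{B_n\Rightarrow x}\ \liminf_n f_{B_n},$$ the sup and inf being over all sequences $\{B_n\}\subset\mathcal{B}(x)$ with $B_n\Rightarrow x$. $\mathcal{B}$ differentiates $L^\infty(\mathbb{T}^\omega)$ if for every $f\in L^\infty(\mathbb{T}^\omega)$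 one has $\overline{D}(\int\! f,x)=\underline{D}(\int\! f,x)=f(x)$ for almost every $x$. *)

theory Defs
  imports "HOL-Analysis.Analysis" "HOL-Library.Discrete_Functions"
begin

section \<open>The infinite torus\<close>

text \<open>
  A point of the infinite torus is a sequence \<open>x :: nat \<Rightarrow> real\<close> with values in \<open>{0..<1}\<close>.
  Indices start at \<open>0\<close>: the coordinate written $x_{k+1}$ on paper is \<open>x k\<close>.
\<close>

definition torus :: "(nat \<Rightarrow> real) set" where
  "torus = (UNIV \<rightarrow>\<^sub>E {0..<1})"

definition haar :: "(nat \<Rightarrow> real) measure" where
  "haar = (\<Pi>\<^sub>M k\<in>UNIV. restrict_space lborel {0..<1})"

text \<open>
  The circle carries the quotient topology along \<open>frac\<close>, not the subspace topology of \<open>{0..<1}\<close>.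
\<close>

definition circle_topology :: "real topology" where
  "circle_topology = topology (\<lambda>U. U \<subseteq> {0..<1} \<and> open {t::real. frac t \<in> U})"

definition torus_topology :: "(nat \<Rightarrow> real) topology" where
  "torus_topology = product_topology (\<lambda>k. circle_topology) UNIV"

definition translate :: "(nat \<Rightarrow> real) \<Rightarrow> (nat \<Rightarrow> real) set \<Rightarrow> (nat \<Rightarrow> real) set" where
  "translate y S = (\<lambda>x k. frac (y k + x k)) ` S"

text \<open>
  The distance of two points of the circle is the distance to \<open>0\<close> modulo \<open>1\<close> of their difference,
  so that \<open>torus_dist\<close> is a metric for the product topology.  The formula below presupposes
  representatives in \<open>{0..<1}\<close>.
\<close>

definition circle_dist :: "real \<Rightarrow> real \<Rightarrow> real" where
  "circle_dist s t = min \<bar>s - t\<bar> (1 - \<bar>s - t\<bar>)"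

definition torus_dist :: "(nat \<Rightarrow> real) \<Rightarrow> (nat \<Rightarrow> real) \<Rightarrow> real" where
  "torus_dist x y = (\<Sum>k. circle_dist (x k) (y k) / 2 ^ Suc k)"

definition torus_diameter :: "(nat \<Rightarrow> real) set \<Rightarrow> real" where
  "torus_diameter S = (SUP (x, y)\<in>S \<times> S. torus_dist x y)"

lemma space_haar: "space haar = torus"
  by (simp add: haar_def torus_def space_PiM space_restrict_space)

lemma openin_circle_topology:
  "openin circle_topology U \<longleftrightarrow> U \<subseteq> {0..<1} \<and> open {t::real. frac t \<in> U}"
proof -
  have "istopology (\<lambda>U. U \<subseteq> {0..<1} \<and> open {t::real. frac t \<in> U})"
    unfolding istopology_def
  proof (intro conjI allI impI)
    fix S T :: "real set"
    assume "S \<subseteq> {0..<1} \<and> open {t::real. frac t \<in> S}"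
      and "T \<subseteq> {0..<1} \<and> open {t::real. frac t \<in> T}"
    then show "S \<inter> T \<subseteq> {0..<1}" "open {t::real. frac t \<in> S \<inter> T}"
      by (auto simp: open_Collect_conj)
  next
    fix K :: "real set set"
    assume K: "\<forall>U\<in>K. U \<subseteq> {0..<1} \<and> open {t::real. frac t \<in> U}"
    then show "\<Union>K \<subseteq> {0..<1}" by blast
    have "{t::real. frac t \<in> \<Union>K} = (\<Union>U\<in>K. {t. frac t \<in> U})" by auto
    with K show "open {t::real. frac t \<in> \<Union>K}" by auto
  qed
  then show ?thesis
    unfolding circle_topology_def by simp
qed

lemma topspace_circle_topology: "topspace circle_topology = {0..<1}"
proof -
  have "{t::real. frac t \<in> {0..<1}} = UNIV"
    by (auto simp: frac_lt_1)
  then have "openin circle_topology {0..<1}"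
    by (simp add: openin_circle_topology)
  then show ?thesis
    by (metis openin_circle_topology openin_subset openin_topspace subset_antisym)
qed

lemma topspace_torus_topology: "topspace torus_topology = torus"
  by (simp add: torus_topology_def torus_def topspace_circle_topology)


section \<open>The extended Rubio de Francia basis\<close>

text \<open>
  \<open>torus_box [l\<^sub>1, \<dots>, l\<^sub>k]\<close> is the product of the intervals $(0, l_i)$ and of full circles in all later
  coordinates.
\<close>

definition torus_box :: "real list \<Rightarrow> (nat \<Rightarrow> real) set" where
  "torus_box ls = {x \<in> torus. \<forall>k<length ls. 0 < x k \<and> x k < ls ! k}"

text \<open>
  Each \<open>m \<ge> 2\<close> is \<open>n\<^sup>2 + j\<close> for exactly one pair with \<open>n \<ge> 1\<close> and \<open>1 \<le> j \<le> 2 * n + 1\<close>,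
  the one with \<open>n = floor_sqrt (m - 1)\<close>; see \<open>rdf_set_square_plus\<close>.
\<close>

definition rdf_sides :: "nat \<Rightarrow> nat \<Rightarrow> real list" where
  "rdf_sides n j =
     (if j \<le> n then replicate n (1 / 2 ^ n) @ [1 / 2 ^ j]
      else replicate (j - n) (1 / 2 ^ (n + 1)) @ replicate (2 * n + 1 - j) (1 / 2 ^ n))"

definition rdf_set :: "nat \<Rightarrow> (nat \<Rightarrow> real) set" where
  "rdf_set m =
     (if m \<le> 1 then torus_box [1 / 2]
      else let n = floor_sqrt (m - 1) in torus_box (rdf_sides n (m - n\<^sup>2)))"

definition rdf_basis :: "(nat \<Rightarrow> real) set set" where
  "rdf_basis = {translate y (rdf_set m) | m y. 1 \<le> m \<and> y \<in> torus}"

definition double_cube :: "nat \<Rightarrow> nat \<Rightarrow> (nat \<Rightarrow> real) set" where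
  "double_cube m r = torus_box ((replicate m (1 / 2 ^ m))[r - 1 := 2 / 2 ^ m])"

definition extended_rdf_basis :: "(nat \<Rightarrow> real) set set" where
  "extended_rdf_basis =
     rdf_basis \<union> {translate y (double_cube m r) | m r y. 2 \<le> m \<and> 1 \<le> r \<and> r \<le> m \<and> y \<in> torus}"

lemma rdf_set_1: "rdf_set 1 = torus_box [1 / 2]"
  by (simp add: rdf_set_def)

lemma rdf_set_square_plus:
  assumes "1 \<le> n" "1 \<le> j" "j \<le> 2 * n + 1"
  shows "rdf_set (n\<^sup>2 + j) = torus_box (rdf_sides n j)"
proof -
  have "1 \<le> n\<^sup>2"
    using assms(1) by simp
  with assms(2) have "\<not> n\<^sup>2 + j \<le> 1"
    by linarith
  moreover have "floor_sqrt (n\<^sup>2 + j - 1) = n"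
    using assms by (intro floor_sqrt_unique) (auto simp: power2_eq_square)
  ultimately show ?thesis
    by (simp add: rdf_set_def)
qed

lemma rdf_set_square:
  assumes "1 \<le> n"
  shows "rdf_set (n\<^sup>2) = torus_box (replicate n (1 / 2 ^ n))"
proof (cases "n = 1")
  case True
  then show ?thesis by (simp add: rdf_set_def)
next
  case False
  with assms obtain k where k: "n = Suc k" "1 \<le> k"
    by (cases n) auto
  have "n\<^sup>2 = k\<^sup>2 + (2 * k + 1)"
    by (simp add: k power2_eq_square)
  with rdf_set_square_plus[of k "2 * k + 1"] k show ?thesis
    by (simp add: rdf_sides_def)
qed


section \<open>Differentiation of integrals\<close>

definition basis_at :: "(nat \<Rightarrow> real) set set \<Rightarrow> (nat \<Rightarrow> real) \<Rightarrow> (nat \<Rightarrow> real) set set" where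
  "basis_at \<B> x = {B \<in> \<B>. x \<in> torus_topology closure_of B}"

definition contracts_to ::
  "(nat \<Rightarrow> real) set set \<Rightarrow> (nat \<Rightarrow> (nat \<Rightarrow> real) set) \<Rightarrow> (nat \<Rightarrow> real) \<Rightarrow> bool" where
  "contracts_to \<B> B x \<longleftrightarrow>
     (\<forall>n. B n \<in> basis_at \<B> x) \<and> (\<lambda>n. torus_diameter (B n)) \<longlonglongrightarrow> 0"

definition average :: "((nat \<Rightarrow> real) \<Rightarrow> real) \<Rightarrow> (nat \<Rightarrow> real) set \<Rightarrow> real" where
  "average f B = (1 / measure haar B) * (LINT x:B|haar. f x)"

definition upper_derivative ::
  "(nat \<Rightarrow> real) set set \<Rightarrow> ((nat \<Rightarrow> real) \<Rightarrow> real) \<Rightarrow> (nat \<Rightarrow> real) \<Rightarrow> ereal" where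
  "upper_derivative \<B> f x =
     (SUP B\<in>{B. contracts_to \<B> B x}. limsup (\<lambda>n. ereal (average f (B n))))"

definition lower_derivative ::
  "(nat \<Rightarrow> real) set set \<Rightarrow> ((nat \<Rightarrow> real) \<Rightarrow> real) \<Rightarrow> (nat \<Rightarrow> real) \<Rightarrow> ereal" where
  "lower_derivative \<B> f x =
     (INF B\<in>{B. contracts_to \<B> B x}. liminf (\<lambda>n. ereal (average f (B n))))"

definition L_infinity :: "((nat \<Rightarrow> real) \<Rightarrow> real) set" where
  "L_infinity = {f \<in> borel_measurable haar. \<exists>C. AE x in haar. \<bar>f x\<bar> \<le> C}"

definition differentiates_L_infinity :: "(nat \<Rightarrow> real) set set \<Rightarrow> bool" where
  "differentiates_L_infinity \<B> \<longleftrightarrow>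
     (\<forall>f\<in>L_infinity. AE x in haar.
        upper_derivative \<B> f x = ereal (f x) \<and> lower_derivative \<B> f x = ereal (f x))"

end

(*
  Divide the first m coordinates into 2^m intervals each, where m is a power of 2 and hence
  divides 2^m.  Among the resulting cells v, the code consists of those with
  0 * v_0 + 1 * v_1 + ... + (m-1) * v_(m-1) = 0 mod m; it has measure 1/m.  As in the perfect
  single-error-correcting codes for the Lee metric, every cell v has a neighbour v + e_r in the
  code, and the double cube formed by v and v + e_r has average at least 1/2 for the indicator of
  the code.  Summing over m = 4, 8, 16, ..., the union E of the codes has measure at most 1/2,
  while the upper derivative of its indicator is at least 1/2 at every point.
*)
theory Submission
  imports Defs "HOL-Probability.Infinite_Product_Measure" "HOL-Number_Theory.Cong"
begin

section \<open>Haar measure and translates\<close>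

lemma prob_space_circle: "prob_space (restrict_space lborel {0..<1::real})"
  by (rule prob_spaceI) (simp add: emeasure_restrict_space space_restrict_space)

interpretation circle: prob_space "restrict_space lborel {0..<1::real}"
  by (rule prob_space_circle)

interpretation torus: product_prob_space "\<lambda>k::nat. restrict_space lborel {0..<1::real}" UNIV
  by unfold_locales

lemma prob_space_haar: "prob_space haar"
  unfolding haar_def by (rule torus.prob_space_axioms)

interpretation haar: prob_space haar
  by (rule prob_space_haar)

lemma measurable_haar_component: "(\<lambda>x. x k) \<in> borel_measurable haar"
proof -
  have "(\<lambda>x. x k) \<in> haar \<rightarrow>\<^sub>M restrict_space lborel {0..<1::real}"
    unfolding haar_def by measurable
  then show ?thesis
    by (simp add: measurable_restrict_space2_iff)
qed

lemma sets_haar_cylinder: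
  assumes "\<And>k. k < m \<Longrightarrow> A k \<in> sets borel"
  shows "{x \<in> torus. \<forall>k<m. x k \<in> A k} \<in> sets haar"
proof -
  have "{x \<in> space haar. \<forall>k\<in>{..<m}. x k \<in> A k} \<in> sets haar"
  proof (rule sets.sets_Collect_finite_All)
    fix k assume "k \<in> {..<m}"
    then have A: "A k \<in> sets borel"
      using assms by blast
    have eq: "{x \<in> space haar. x k \<in> A k} = (\<lambda>x. x k) -` A k \<inter> space haar"
      by blast
    show "{x \<in> space haar. x k \<in> A k} \<in> sets haar"
      unfolding eq by (rule measurable_sets[OF measurable_haar_component A])
  qed (rule finite_lessThan)
  moreover have "{x \<in> space haar. \<forall>k\<in>{..<m}. x k \<in> A k} = {x \<in> torus. \<forall>k<m. x k \<in> A k}"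
    by (auto simp: space_haar)
  ultimately show ?thesis
    by (rule subst[rotated])
qed

text \<open>Each factor is Lebesgue measure restricted to \<open>{0..<1}\<close>; the inclusion of
  \<open>A k\<close> in that interval lets \<open>lborel\<close> replace it.\<close>

lemma measure_haar_cylinder:
  assumes "\<And>k. k < m \<Longrightarrow> A k \<in> sets borel" "\<And>k. k < m \<Longrightarrow> A k \<subseteq> {0..<1}"
  shows "measure haar {x \<in> torus. \<forall>k<m. x k \<in> A k} = (\<Prod>k<m. measure lborel (A k))"
proof -
  have eq: "{x \<in> torus. \<forall>k<m. x k \<in> A k} =
      prod_emb UNIV (\<lambda>k. restrict_space lborel {0..<1::real}) {..<m} (\<Pi>\<^sub>E k\<in>{..<m}. A k)"
    by (auto simp: prod_emb_def torus_def space_restrict_space PiE_iff)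
  have A: "A k \<in> sets (restrict_space lborel {0..<1})" if "k < m" for k
    using assms[OF that] by (auto simp: sets_restrict_space_iff)
  have "measure haar {x \<in> torus. \<forall>k<m. x k \<in> A k}
      = (\<Prod>k<m. measure (restrict_space lborel {0..<1}) (A k))"
    unfolding eq haar_def using A by (intro torus.measure_PiM_emb) auto
  also have "\<dots> = (\<Prod>k<m. measure lborel (A k))"
    using assms by (intro prod.cong) (auto simp: measure_restrict_space)
  finally show ?thesis .
qed

text \<open>Translation by \<open>y\<close> is inverted by taking \<open>frac (x k - y k)\<close> in
  each coordinate. In this form boxes that wrap around past 1 require no separate cases.\<close>

lemma translate_torus_box:
  assumes "y \<in> torus"
  shows "translate y (torus_box ls) =
    {x \<in> torus. \<forall>k<length ls. 0 < frac (x k - y k) \<and> frac (x k - y k) < ls ! k}"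
    (is "_ = ?R")
proof -
  have cancel: "frac (frac (a + t) - a) = t" if "0 \<le> t" "t < 1" for a t :: real
    using that frac_add_simps(1)[of "a + t" "- a"] by (simp add: frac_eq)
  have cancel': "frac (a + frac (s - a)) = s" if "0 \<le> s" "s < 1" for a s :: real
    using that by (simp add: frac_eq)
  show ?thesis
  proof (intro equalityI subsetI)
    fix x assume "x \<in> translate y (torus_box ls)"
    then obtain z where z: "z \<in> torus_box ls" and x: "x = (\<lambda>k. frac (y k + z k))"
      by (auto simp: translate_def)
    have "0 \<le> z k" "z k < 1" for k
      using z by (auto simp: torus_box_def torus_def PiE_iff)
    then have "frac (x k - y k) = z k" for k
      by (simp add: x cancel)
    moreover have "x \<in> torus"
      by (auto simp: x torus_def frac_lt_1)
    ultimately show "x \<in> ?R"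
      using z by (simp add: torus_box_def del: frac_gt_0_iff)
  next
    fix x assume x: "x \<in> ?R"
    have "0 \<le> x k" "x k < 1" for k
      using x by (auto simp: torus_def PiE_iff)
    then have "x = (\<lambda>k. frac (y k + frac (x k - y k)))"
      by (simp add: cancel')
    moreover have "(\<lambda>k. frac (x k - y k)) \<in> torus"
      by (auto simp: torus_def frac_lt_1)
    then have "(\<lambda>k. frac (x k - y k)) \<in> torus_box ls"
      using x by (simp add: torus_box_def del: frac_gt_0_iff)
    ultimately show "x \<in> translate y (torus_box ls)"
      unfolding translate_def by (rule image_eqI)
  qed
qed

section \<open>Topology and metric\<close>

text \<open>Points of the interval are approached from the right, inside \<open>{0..<1}\<close>,
  where \<open>frac\<close> is the identity. So the left endpoint, even 0, is a limit point in the
  quotient topology, and half-open intervals lie in the closure of open ones.\<close>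

lemma circle_closure_of:
  assumes "0 \<le> a" "a \<le> t" "t < b" "b \<le> 1"
  shows "t \<in> circle_topology closure_of {a<..<b}"
  unfolding in_closure_of
proof (intro conjI allI impI)
  show "t \<in> topspace circle_topology"
    using assms by (simp add: topspace_circle_topology)
next
  fix U assume "t \<in> U \<and> openin circle_topology U"
  then have "open {s. frac s \<in> U}" "t \<in> {s. frac s \<in> U}"
    using assms by (auto simp: openin_circle_topology frac_eq[THEN iffD2])
  then obtain e where e: "e > 0" "\<And>s. dist s t < e \<Longrightarrow> frac s \<in> U"
    unfolding open_dist by blast
  \<comment> \<open>Half of each gap keeps \<open>s\<close> below \<open>b\<close> and within
    \<open>e\<close> of \<open>t\<close>.\<close>
  define s where "s = t + min (e / 2) ((b - t) / 2)"
  have s: "t < s" "s < b" "dist s t < e"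
    using e(1) assms by (auto simp: s_def dist_real_def min_def field_simps)
  then have "frac s = s"
    using assms by (simp add: frac_eq)
  then show "\<exists>y. y \<in> {a<..<b} \<and> y \<in> U"
    using s e(2)[of s] assms by (intro exI[of _ s]) auto
qed

section \<open>Distances and diameters on the torus\<close>

lemma circle_dist_bounds:
  assumes "s \<in> {0..<1}" "t \<in> {0..<1}"
  shows "0 \<le> circle_dist s t" "circle_dist s t \<le> 1"
  using assms by (auto simp: circle_dist_def)

text \<open>The two differences agree up to an integer \<open>n\<close> of absolute value less than
  2. For \<open>n = 0\<close> they coincide; for \<open>n = 1\<close> and \<open>n = -1\<close> the
  second term of the minimum in \<open>circle_dist\<close>, the way round the circle, equals the
  right-hand side.\<close>

lemma circle_dist_frac_diff:
  assumes "s \<in> {0..<1}" "t \<in> {0..<1}"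
  shows "circle_dist s t \<le> \<bar>frac (s - a) - frac (t - a)\<bar>"
proof -
  define n where "n = \<lfloor>s - a\<rfloor> - \<lfloor>t - a\<rfloor>"
  have eq: "s - t = frac (s - a) - frac (t - a) + of_int n"
    by (simp add: frac_def n_def)
  have "\<bar>of_int n :: real\<bar> < 2"
    using eq assms frac_lt_1[of "s - a"] frac_lt_1[of "t - a"] frac_ge_0[of "s - a"]
      frac_ge_0[of "t - a"] unfolding atLeastLessThan_iff by linarith
  then have "\<bar>n\<bar> < 2"
    by linarith
  then consider "n = -1" | "n = 0" | "n = 1"
    by linarith
  then show ?thesis
    using eq by cases (auto simp: circle_dist_def)
qed

text \<open>The weights sum to 1, so the first \<open>m\<close> coordinates contribute at most
  \<open>e\<close>. The others have circle distance at most 1 and total weight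
  \<open>1 / 2 ^ m\<close>.\<close>

lemma torus_dist_le:
  assumes "x \<in> torus" "y \<in> torus" "0 \<le> e" "\<And>k. k < m \<Longrightarrow> circle_dist (x k) (y k) \<le> e"
  shows "0 \<le> torus_dist x y" "torus_dist x y \<le> e + 1 / 2 ^ m"
proof -
  let ?f = "\<lambda>k. circle_dist (x k) (y k) / 2 ^ Suc k"
  have b: "0 \<le> circle_dist (x k) (y k)" "circle_dist (x k) (y k) \<le> 1" for k
    using assms(1,2) circle_dist_bounds by (auto simp: torus_def PiE_iff)
  have geo: "(\<lambda>k. c / 2 ^ Suc k) sums c" for c :: real
    using sums_mult[OF power_half_series, of c] by (simp add: power_divide)
  have f: "summable ?f"
    by (rule summable_comparison_test'[OF sums_summable[OF geo[of 1]]])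
      (use b in \<open>auto intro!: divide_right_mono\<close>)
  then show "0 \<le> torus_dist x y"
    unfolding torus_dist_def using b by (intro suminf_nonneg) auto
  have "(\<Sum>k. ?f (k + m)) \<le> (\<Sum>k. (1 / 2 ^ m) / 2 ^ Suc k)"
  proof (rule suminf_le)
    show "?f (k + m) \<le> (1 / 2 ^ m) / 2 ^ Suc k" for k
      using b[of "k + m"] by (simp add: power_add field_simps)
    show "summable (\<lambda>k. ?f (k + m))"
      using f by (subst summable_iff_shift)
    show "summable (\<lambda>k. (1 / 2 ^ m) / 2 ^ Suc k :: real)"
      by (rule sums_summable[OF geo])
  qed
  also have "\<dots> = 1 / 2 ^ m"
    by (rule sums_unique[OF geo, symmetric])
  finally have tail: "(\<Sum>k. ?f (k + m)) \<le> 1 / 2 ^ m" .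
  have "(\<Sum>k<m. ?f k) \<le> (\<Sum>k<m. e / 2 ^ Suc k)"
    using assms(4) by (intro sum_mono divide_right_mono) auto
  also have "\<dots> \<le> (\<Sum>k. e / 2 ^ Suc k)"
    using \<open>0 \<le> e\<close> by (intro sum_le_suminf sums_summable[OF geo]) auto
  also have "\<dots> = e"
    by (rule sums_unique[OF geo, symmetric])
  finally show "torus_dist x y \<le> e + 1 / 2 ^ m"
    unfolding torus_dist_def using suminf_split_initial_segment[OF f, of m] tail by linarith
qed

lemma torus_diameter_bounds:
  assumes "S \<noteq> {}" "S \<subseteq> torus" "\<And>x y. x \<in> S \<Longrightarrow> y \<in> S \<Longrightarrow> torus_dist x y \<le> d"
    "\<And>x y. x \<in> S \<Longrightarrow> y \<in> S \<Longrightarrow> 0 \<le> torus_dist x y"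
  shows "0 \<le> torus_diameter S" "torus_diameter S \<le> d"
proof -
  obtain x where x: "x \<in> S"
    using assms(1) by blast
  have "bdd_above ((\<lambda>(x, y). torus_dist x y) ` (S \<times> S))"
    using assms(3) by (intro bdd_aboveI[of _ d]) auto
  \<comment> \<open>A real supremum dominates its members once they are bounded above; the pair
    \<open>(x, x)\<close> then gives the lower bound.\<close>
  then have "(\<lambda>(x, y). torus_dist x y) (x, x) \<le> torus_diameter S"
    unfolding torus_diameter_def using x by (intro cSUP_upper) auto
  then show "0 \<le> torus_diameter S"
    using assms(4)[OF x x] by simp
  show "torus_diameter S \<le> d"
    unfolding torus_diameter_def using x assms(3) by (intro cSUP_least) auto
qed

section \<open>Grid cells and the code\<close>

text \<open>Half-open cells cover the torus, while open cells fit inside translated open boxes. Both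
  have the same measure, so passing between them costs nothing.\<close>

definition cell :: "nat \<Rightarrow> (nat \<Rightarrow> nat) \<Rightarrow> (nat \<Rightarrow> real) set" where
  "cell m v = {x \<in> torus. \<forall>k<m. x k \<in> {real (v k) / 2 ^ m..<(real (v k) + 1) / 2 ^ m}}"

definition open_cell :: "nat \<Rightarrow> (nat \<Rightarrow> nat) \<Rightarrow> (nat \<Rightarrow> real) set" where
  "open_cell m v = {x \<in> torus. \<forall>k<m. x k \<in> {real (v k) / 2 ^ m<..<(real (v k) + 1) / 2 ^ m}}"

text \<open>Extensionality leaves one function per cell, so that cells can be counted as
  functions.\<close>

definition grid :: "nat \<Rightarrow> (nat \<Rightarrow> nat) set" where
  "grid m = {..<m} \<rightarrow>\<^sub>E {..<2 ^ m}"

text \<open>The weights run through every residue modulo \<open>m\<close> once. Weight 0 at index 0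
  serves the words already in the code: a step in that direction stays in it.\<close>

definition code :: "nat \<Rightarrow> (nat \<Rightarrow> nat) set" where
  "code m = {v \<in> grid m. m dvd (\<Sum>i<m. i * v i)}"

definition code_set :: "nat \<Rightarrow> (nat \<Rightarrow> real) set" where
  "code_set m = (\<Union>v\<in>code m. cell m v)"

lemma open_cell_subset_cell: "open_cell m v \<subseteq> cell m v"
  by (auto simp: open_cell_def cell_def less_imp_le)

lemma grid_interval:
  assumes "v \<in> grid m" "k < m"
  shows "0 \<le> real (v k) / 2 ^ m" "(real (v k) + 1) / 2 ^ m \<le> 1"
proof -
  have "v k < 2 ^ m"
    using assms by (auto simp: grid_def)
  then have "real (Suc (v k)) \<le> real (2 ^ m)"
    by (intro of_nat_mono Suc_leI)
  then show "(real (v k) + 1) / 2 ^ m \<le> 1"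
    by (simp add: field_simps)
qed simp

lemma grid_interval_subset:
  assumes "v \<in> grid m" "k < m"
  shows "{real (v k) / 2 ^ m..<(real (v k) + 1) / 2 ^ m} \<subseteq> {0..<1}"
    and "{real (v k) / 2 ^ m<..<(real (v k) + 1) / 2 ^ m} \<subseteq> {0..<1}"
proof -
  have "{a..<b} \<subseteq> {0..<1}" "{a<..<b} \<subseteq> {0..<1}" if "0 \<le> a" "b \<le> 1" for a b :: real
    using that by auto
  from this[OF grid_interval[OF assms]]
  show "{real (v k) / 2 ^ m..<(real (v k) + 1) / 2 ^ m} \<subseteq> {0..<1}"
    and "{real (v k) / 2 ^ m<..<(real (v k) + 1) / 2 ^ m} \<subseteq> {0..<1}" .
qed

lemma sets_cell [measurable]: "cell m v \<in> sets haar" "open_cell m v \<in> sets haar"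
  unfolding cell_def open_cell_def by (rule sets_haar_cylinder, simp)+

lemma measure_cell:
  assumes "v \<in> grid m"
  shows "measure haar (cell m v) = 1 / 2 ^ (m * m)" "measure haar (open_cell m v) = 1 / 2 ^ (m * m)"
proof -
  have len: "(real a + 1) / 2 ^ m - real a / 2 ^ m = 1 / 2 ^ m" "real a / 2 ^ m \<le> (real a + 1) / 2 ^ m" for a
    by (simp_all add: field_simps)
  have pow: "(1 / 2 ^ m) ^ m = (1 / 2 ^ (m * m) :: real)"
    by (simp add: power_divide power_mult)
  note I = grid_interval_subset[OF assms]
  show "measure haar (cell m v) = 1 / 2 ^ (m * m)"
    unfolding cell_def by (subst measure_haar_cylinder[OF _ I(1)]) (simp_all add: len pow)
  show "measure haar (open_cell m v) = 1 / 2 ^ (m * m)"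
    unfolding open_cell_def by (subst measure_haar_cylinder[OF _ I(2)]) (simp_all add: len pow)
qed

section \<open>Size of the code and measure of its cells\<close>

lemma finite_grid: "finite (grid m)"
  unfolding grid_def by (intro finite_PiE) auto

lemma card_grid: "card (grid m) = 2 ^ (m * m)"
  by (simp add: grid_def card_PiE power_mult)

lemma finite_code: "finite (code m)"
  using finite_grid by (auto simp: code_def)

lemma sets_code_set [measurable]: "code_set m \<in> sets haar"
  unfolding code_set_def using finite_code by (intro sets.finite_UN) auto

lemma grid_shift:
  assumes "v \<in> grid m" "r < m"
  shows "v(r := (v r + c) mod 2 ^ m) \<in> grid m"
proof -
  have "v(r := (v r + c) mod 2 ^ m) \<in> insert r {..<m} \<rightarrow>\<^sub>E {..<2 ^ m}"
    using assms(1) unfolding grid_def by (intro PiE_fun_upd) auto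
  moreover have "insert r {..<m} = {..<m}"
    using assms(2) by auto
  ultimately show ?thesis
    by (simp add: grid_def)
qed

text \<open>On the circle the last interval is followed by the first, hence the reduction modulo
  \<open>2 ^ m\<close>. As \<open>m\<close> divides \<open>2 ^ m\<close>, wrapping around is
  invisible modulo \<open>m\<close>.\<close>

lemma weight_shift:
  assumes "m dvd 2 ^ m" "r < m"
  shows "(\<Sum>i<m. i * (v(r := (v r + c) mod 2 ^ m)) i) mod m = ((\<Sum>i<m. i * v i) + r * c) mod m"
proof -
  let ?s = "\<Sum>i\<in>{..<m} - {r}. i * v i"
  have split: "(\<Sum>i<m. i * (v(r := a)) i) = r * a + ?s" for a
  proof -
    have "(\<Sum>i<m. i * (v(r := a)) i) = r * a + (\<Sum>i\<in>{..<m} - {r}. i * (v(r := a)) i)"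
      using assms(2) sum.remove[of "{..<m}" r "\<lambda>i. i * (v(r := a)) i"] by simp
    then show ?thesis
      by simp
  qed
  have "[(v r + c) mod 2 ^ m = v r + c] (mod m)"
    unfolding cong_def using assms(1) by (rule mod_mod_cancel)
  then have "[r * ((v r + c) mod 2 ^ m) + ?s = r * (v r + c) + ?s] (mod m)"
    by (intro cong_add cong_mult cong_refl)
  moreover have "r * (v r + c) + ?s = (\<Sum>i<m. i * v i) + r * c"
    using split[of "v r"] by (simp add: algebra_simps)
  ultimately show ?thesis
    unfolding split cong_def by simp
qed

text \<open>
  Coordinate 1 has weight 1, so shifting it by \<open>c < m\<close> produces disjoint translates of the code.
\<close>

lemma card_code_le:
  assumes "2 \<le> m" "m dvd 2 ^ m"
  shows "m * card (code m) \<le> 2 ^ (m * m)"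
proof -
  define h :: "(nat \<Rightarrow> nat) \<times> nat \<Rightarrow> nat \<Rightarrow> nat"
    where "h = (\<lambda>(v, c). v(1 := (v 1 + c) mod 2 ^ m))"
  \<comment> \<open>Code words have weighted sum 0 modulo \<open>m\<close>, so the residue of the
    shifted word recovers \<open>c\<close>; this is the key to injectivity of
    \<open>h\<close>.\<close>
  have weight: "(\<Sum>i<m. i * h (v, c) i) mod m = c" if "v \<in> code m" "c < m" for v c
    using that assms weight_shift[of m 1 v c] by (auto simp: code_def h_def mod_add_eq dvd_def)
  have "inj_on h (code m \<times> {..<m})"
  proof (rule inj_onI, clarify)
    fix v c w d
    assume v: "v \<in> code m" "c < m" and w: "w \<in> code m" "d < m" and eq: "h (v, c) = h (w, d)"
    have cd: "c = d"
      using weight[OF v] weight[OF w] eq by simp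
    have "v k = w k" for k
    proof (cases "k = 1")
      case True
      have "(v 1 + c) mod 2 ^ m = (w 1 + c) mod 2 ^ m"
        using fun_cong[OF eq, of 1] cd by (simp add: h_def)
      then have "v 1 mod 2 ^ m = w 1 mod 2 ^ m"
        by (meson cong_add_rcancel_nat cong_def)
      moreover have "v 1 < 2 ^ m" "w 1 < 2 ^ m"
        using v w assms by (auto simp: code_def grid_def PiE_iff)
      ultimately show ?thesis
        using True by simp
    next
      case False
      then show ?thesis
        using fun_cong[OF eq, of k] by (simp add: h_def)
    qed
    then show "v = w \<and> c = d"
      using cd by auto
  qed
  moreover have "h ` (code m \<times> {..<m}) \<subseteq> grid m"
    using assms grid_shift[of _ m 1] by (auto simp: h_def code_def)
  ultimately have "card (code m \<times> {..<m}) \<le> card (grid m)"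
    using finite_grid by (rule card_inj_on_le)
  then show ?thesis
    by (simp add: card_cartesian_product card_grid mult.commute)
qed

text \<open>A union bound over at most \<open>2 ^ (m * m) / m\<close> cells of measure
  \<open>1 / 2 ^ (m * m)\<close> each.\<close>

lemma measure_code_set_le:
  assumes "2 \<le> m" "m dvd 2 ^ m"
  shows "measure haar (code_set m) \<le> 1 / m"
proof -
  have "measure haar (code_set m) \<le> (\<Sum>v\<in>code m. measure haar (cell m v))"
    unfolding code_set_def using finite_code by (intro haar.finite_measure_subadditive_finite) auto
  also have "\<dots> = card (code m) / 2 ^ (m * m)"
    by (simp add: measure_cell code_def)
  also have "\<dots> \<le> 1 / m"
  proof -
    have "real (m * card (code m)) \<le> real (2 ^ (m * m))"
      using card_code_le[OF assms] by (simp only: of_nat_le_iff)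
    then show ?thesis
      using assms by (simp add: field_simps)
  qed
  finally show ?thesis .
qed

section \<open>Locating a point in the grid\<close>

lemma torus_in_cell:
  assumes "x \<in> torus"
  obtains v where "v \<in> grid m" "x \<in> cell m v"
proof
  let ?v = "\<lambda>k\<in>{..<m}. nat \<lfloor>2 ^ m * x k\<rfloor>"
  have x: "0 \<le> x k" "x k < 1" for k
    using assms by (auto simp: torus_def PiE_iff)
  have "\<lfloor>2 ^ m * x k\<rfloor> < 2 ^ m" for k
    using x[of k] by (simp add: floor_less_iff)
  then show "?v \<in> grid m"
    by (auto simp: grid_def nat_less_iff x)
  show "x \<in> cell m ?v"
    unfolding cell_def
  proof (intro CollectI conjI allI impI assms)
    fix k assume "k < m"
    have "0 \<le> 2 ^ m * x k"
      using x by simp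
    then have "real (?v k) = of_int \<lfloor>2 ^ m * x k\<rfloor>"
      using \<open>k < m\<close> by simp
    then have "real (?v k) \<le> 2 ^ m * x k" "2 ^ m * x k < real (?v k) + 1"
      by linarith+
    then show "x k \<in> {real (?v k) / 2 ^ m..<(real (?v k) + 1) / 2 ^ m}"
      by (simp add: pos_divide_le_eq pos_less_divide_eq mult.commute del: restrict_apply')
  qed
qed

text \<open>Closures in a product are taken coordinatewise. The factors \<open>I k\<close> are open
  grid intervals for \<open>k < m\<close> and full circles beyond.\<close>

lemma closure_of_open_cell:
  assumes "v \<in> grid m" "x \<in> cell m v"
  shows "x \<in> torus_topology closure_of (open_cell m v)"
proof -
  define I where "I = (\<lambda>k. if k < m then {real (v k) / 2 ^ m<..<(real (v k) + 1) / 2 ^ m} else {0..<1})"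
  have I: "I k = {real (v k) / 2 ^ m<..<(real (v k) + 1) / 2 ^ m}" if "k < m" for k
    using that by (simp add: I_def)
  have I': "I k = {0..<1}" if "\<not> k < m" for k
    using that by (simp add: I_def)
  have sub: "I k \<subseteq> {0..<1}" for k
    using grid_interval_subset(2)[OF assms(1)] I I' by (cases "k < m") blast+
  have eq: "open_cell m v = (\<Pi>\<^sub>E k\<in>UNIV. I k)"
  proof (intro equalityI subsetI)
    fix x assume "x \<in> open_cell m v"
    then have "x k \<in> I k" for k
      by (cases "k < m") (simp_all add: I I' open_cell_def torus_def PiE_iff)
    then show "x \<in> (\<Pi>\<^sub>E k\<in>UNIV. I k)"
      by (simp add: PiE_iff)
  next
    fix x assume "x \<in> (\<Pi>\<^sub>E k\<in>UNIV. I k)"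
    then have x: "x k \<in> I k" for k
      by (simp add: PiE_iff)
    then have "x k \<in> {0..<1}" for k
      using sub by blast
    then have "x \<in> torus"
      by (simp add: torus_def PiE_iff)
    then show "x \<in> open_cell m v"
      unfolding open_cell_def using x I by blast
  qed
  have "x k \<in> circle_topology closure_of (I k)" for k
  proof (cases "k < m")
    case True
    then have "real (v k) / 2 ^ m \<le> x k" "x k < (real (v k) + 1) / 2 ^ m"
      using assms(2) by (auto simp: cell_def)
    then show ?thesis
      unfolding I[OF True] using grid_interval[OF assms(1) True] by (intro circle_closure_of)
  next
    case False
    have "x k \<in> {0..<1}"
      using assms(2) by (simp add: cell_def torus_def PiE_iff)
    then show ?thesis
      using closure_of_topspace[of circle_topology] by (simp add: topspace_circle_topology I'[OF False])
  qed
  then show ?thesis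
    unfolding torus_topology_def eq closure_of_product_topology by (simp add: PiE_iff)
qed

section \<open>Double cubes on the grid\<close>

text \<open>The difference \<open>s - a / N\<close> lies strictly between -1 and 1, so
  \<open>frac\<close> adds 0 or 1 according to its sign. Scaling by \<open>N\<close> turns all
  conditions into linear ones in \<open>N * s\<close>.\<close>

lemma frac_grid:
  fixes s :: real and a N :: nat
  assumes "0 \<le> s" "s < 1" "a < N"
  shows "0 < frac (s - a / N) \<longleftrightarrow> N * s \<noteq> a"
    and "frac (s - a / N) < c / N \<longleftrightarrow> (if a \<le> N * s then N * s - a < c else N * s - a + N < c)"
proof -
  have N: "0 < real N" "real a < real N"
    using assms by auto
  have "frac (s - a / N) = (if a \<le> N * s then s - a / N else s - a / N + 1)"
  proof (cases "a \<le> N * s")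
    case True
    then have "a / N \<le> s"
      using N by (simp add: pos_divide_le_eq mult.commute)
    moreover have "0 \<le> a / N"
      by simp
    ultimately have "0 \<le> s - a / N" "s - a / N < 1"
      using assms(2) by linarith+
    then have "frac (s - a / N) = s - a / N"
      by (simp add: frac_eq)
    then show ?thesis
      using True by simp
  next
    case False
    then have "s < a / N"
      using N by (simp add: pos_less_divide_eq mult.commute)
    moreover have "a / N < 1"
      using N by simp
    ultimately have "0 \<le> s - a / N + 1" "s - a / N + 1 < 1"
      using assms(1) by linarith+
    then have "frac (s - a / N + 1) = s - a / N + 1"
      by (simp add: frac_eq)
    then show ?thesis
      using False by (simp add: frac_1_eq)
  qed
  then have "frac (s - a / N) = (if a \<le> N * s then N * s - a else N * s - a + N) / N"
    using N by (simp add: field_simps)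
  moreover have "0 \<le> N * s"
    using assms by simp
  ultimately show "0 < frac (s - a / N) \<longleftrightarrow> N * s \<noteq> a"
    and "frac (s - a / N) < c / N \<longleftrightarrow> (if a \<le> N * s then N * s - a < c else N * s - a + N < c)"
    using N by (auto simp: zero_less_divide_iff divide_less_cancel simp del: frac_gt_0_iff)
qed

text \<open>One coordinate of the comparison between boxes and cells: side \<open>1 / N\<close>
  matches interval \<open>a\<close>, side \<open>2 / N\<close> matches \<open>a\<close> together
  with its cyclic successor \<open>b\<close>. Open intervals give the inner inclusions, half-open
  ones the outer.\<close>

lemma double_cube_coordinate:
  fixes s :: real and a N :: nat
  assumes "0 \<le> s" "s < 1" "a < N" "2 \<le> N"
  defines "b \<equiv> (a + 1) mod N"
  shows "s \<in> {real a / N<..<(real a + 1) / N} \<Longrightarrow> 0 < frac (s - a / N) \<and> frac (s - a / N) < 1 / N"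
    and "s \<in> {real a / N<..<(real a + 1) / N} \<Longrightarrow> 0 < frac (s - a / N) \<and> frac (s - a / N) < 2 / N"
    and "s \<in> {real b / N<..<(real b + 1) / N} \<Longrightarrow> 0 < frac (s - a / N) \<and> frac (s - a / N) < 2 / N"
    and "frac (s - a / N) < 1 / N \<Longrightarrow> s \<in> {real a / N..<(real a + 1) / N}"
    and "frac (s - a / N) < 2 / N \<Longrightarrow> s \<in> {real a / N..<(real a + 1) / N} \<or> s \<in> {real b / N..<(real b + 1) / N}"
proof -
  have N: "2 \<le> real N" "real a + 1 \<le> real N" "0 \<le> N * s" "N * s < N"
    using assms by auto
  have I: "s \<in> {c / N<..<(c + 1) / N} \<longleftrightarrow> c < N * s \<and> N * s < c + 1"
    "s \<in> {c / N..<(c + 1) / N} \<longleftrightarrow> c \<le> N * s \<and> N * s < c + 1" for c :: real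
    using N by (auto simp: field_simps)
  \<comment> \<open>Either the successor wraps around to 0 or it is \<open>a + 1\<close>; these
    cases reduce the claims to linear arithmetic.\<close>
  have b: "real a + 1 = real N \<and> real b = 0 \<or> real b = real a + 1 \<and> real b + 1 \<le> real N"
  proof (cases "a + 1 = N")
    case True
    then show ?thesis
      by (auto simp: b_def)
  next
    case False
    then have "b = a + 1" "b + 1 \<le> N"
      using assms(3) by (simp_all add: b_def)
    then show ?thesis
      by simp
  qed
  note F = frac_grid[OF assms(1-3)]
  show "s \<in> {real a / N<..<(real a + 1) / N} \<Longrightarrow> 0 < frac (s - a / N) \<and> frac (s - a / N) < 1 / N"
    and "s \<in> {real a / N<..<(real a + 1) / N} \<Longrightarrow> 0 < frac (s - a / N) \<and> frac (s - a / N) < 2 / N"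
    and "frac (s - a / N) < 1 / N \<Longrightarrow> s \<in> {real a / N..<(real a + 1) / N}"
    unfolding I F using N by (auto split: if_splits)
  show "s \<in> {real b / N<..<(real b + 1) / N} \<Longrightarrow> 0 < frac (s - a / N) \<and> frac (s - a / N) < 2 / N"
    unfolding I F using N b by (smt (verit))
  show "frac (s - a / N) < 2 / N \<Longrightarrow> s \<in> {real a / N..<(real a + 1) / N} \<or> s \<in> {real b / N..<(real b + 1) / N}"
    unfolding I F using N b by (smt (verit))
qed

text \<open>
  Directions \<open>r\<close> count from 0 here, but from 1 in \<open>double_cube\<close>.
\<close>

definition double_cell :: "nat \<Rightarrow> (nat \<Rightarrow> nat) \<Rightarrow> nat \<Rightarrow> (nat \<Rightarrow> real) set" where
  "double_cell m v r = {x \<in> torus. \<forall>k<m. 0 < frac (x k - v k / 2 ^ m) \<and>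
     frac (x k - v k / 2 ^ m) < (if k = r then 2 else 1) / 2 ^ m}"

lemma double_cell_in_basis:
  assumes "2 \<le> m" "v \<in> grid m" "r < m"
  shows "double_cell m v r \<in> extended_rdf_basis"
proof -
  \<comment> \<open>The corner of cell \<open>v\<close>, extended by 0 to a point of the
    torus.\<close>
  define y where "y = (\<lambda>k. if k < m then real (v k) / 2 ^ m else 0)"
  have "v k < 2 ^ m" if "k < m" for k
    using assms(2) that by (auto simp: grid_def)
  then have y: "y \<in> torus"
    by (auto simp: y_def torus_def)
  have side: "(replicate m (1 / 2 ^ m))[Suc r - 1 := 2 / 2 ^ m] ! k = (if k = r then 2 else 1) / (2 ^ m :: real)"
    if "k < m" for k
    using that assms(3) by (simp add: nth_list_update)
  have corner: "y k = v k / 2 ^ m" if "k < m" for k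
    using that by (simp add: y_def)
  have "double_cell m v r = translate y (double_cube m (Suc r))"
    unfolding double_cube_def translate_torus_box[OF y] double_cell_def length_list_update length_replicate
    by (simp only: side corner cong: conj_cong imp_cong)
  then have "\<exists>m' r' y'. double_cell m v r = translate y' (double_cube m' r') \<and>
      2 \<le> m' \<and> 1 \<le> r' \<and> r' \<le> m' \<and> y' \<in> torus"
    using assms(1,3) y by (intro exI conjI) (assumption, simp_all)
  then show ?thesis
    unfolding extended_rdf_basis_def by blast
qed

text \<open>Up to boundaries the double cell is the union of the cells \<open>v\<close> and
  \<open>w\<close>. This can be checked coordinate by coordinate because only coordinate
  \<open>r\<close> has the doubled side.\<close>

lemma double_cell_cells:
  assumes "2 \<le> m" "v \<in> grid m" "r < m"
  defines "w \<equiv> v(r := (v r + 1) mod 2 ^ m)"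
  shows "open_cell m v \<subseteq> double_cell m v r"
    and "open_cell m w \<subseteq> double_cell m v r"
    and "double_cell m v r \<subseteq> cell m v \<union> cell m w"
proof -
  have "(2::nat) ^ 1 \<le> 2 ^ m"
    using assms(1) by (intro power_increasing) auto
  then have C: "0 \<le> x k \<and> x k < 1 \<and> v k < 2 ^ m \<and> (2::nat) \<le> 2 ^ m" if "x \<in> torus" "k < m" for x k
    using that assms(2) by (auto simp: torus_def grid_def PiE_iff)
  note D = double_cube_coordinate[where N = "2 ^ m", simplified of_nat_power of_nat_numeral of_nat_add of_nat_1]
  show "open_cell m v \<subseteq> double_cell m v r"
  proof
    fix x assume x: "x \<in> open_cell m v"
    then have t: "x \<in> torus"
      by (simp add: open_cell_def)
    have "0 < frac (x k - v k / 2 ^ m) \<and> frac (x k - v k / 2 ^ m) < (if k = r then 2 else 1) / 2 ^ m"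
      if "k < m" for k
      using D(1,2)[of "x k" "v k"] C[OF t that] x that
      by (cases "k = r") (auto simp: open_cell_def simp del: frac_gt_0_iff)
    then show "x \<in> double_cell m v r"
      using t by (simp add: double_cell_def)
  qed
  show "open_cell m w \<subseteq> double_cell m v r"
  proof
    fix x assume x: "x \<in> open_cell m w"
    then have t: "x \<in> torus"
      by (simp add: open_cell_def)
    have "0 < frac (x k - v k / 2 ^ m) \<and> frac (x k - v k / 2 ^ m) < (if k = r then 2 else 1) / 2 ^ m"
      if "k < m" for k
      using D(1,3)[of "x k" "v k"] C[OF t that] x that
      by (cases "k = r") (auto simp: open_cell_def w_def simp del: frac_gt_0_iff)
    then show "x \<in> double_cell m v r"
      using t by (simp add: double_cell_def)
  qed
  show "double_cell m v r \<subseteq> cell m v \<union> cell m w"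
  proof
    fix x assume x: "x \<in> double_cell m v r"
    then have t: "x \<in> torus"
      by (simp add: double_cell_def)
    have *: "frac (x k - v k / 2 ^ m) < (if k = r then 2 else 1) / 2 ^ m" if "k < m" for k
      using x that by (simp add: double_cell_def)
    define J :: "(nat \<Rightarrow> nat) \<Rightarrow> nat \<Rightarrow> real set"
      where "J = (\<lambda>u k. {real (u k) / 2 ^ m..<(real (u k) + 1) / 2 ^ m})"
    have "x r \<in> J v r \<or> x r \<in> J w r"
      using D(5)[of "x r" "v r"] C[OF t assms(3)] *[OF assms(3)] by (simp add: J_def w_def)
    moreover have "x k \<in> J v k" "J w k = J v k" if "k < m" "k \<noteq> r" for k
      using D(4)[of "x k" "v k"] C[OF t that(1)] *[OF that(1)] that(2) by (simp_all add: J_def w_def)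
    \<comment> \<open>Only coordinate \<open>r\<close> leaves a choice, and it decides between the
      two cells.\<close>
    ultimately have "(\<forall>k<m. x k \<in> J v k) \<or> (\<forall>k<m. x k \<in> J w k)"
      by metis
    then show "x \<in> cell m v \<union> cell m w"
      using t unfolding cell_def J_def by blast
  qed
qed

lemma sets_double_cell [measurable]: "double_cell m v r \<in> sets haar"
proof -
  have "double_cell m v r = {x \<in> torus. \<forall>k<m. x k \<in> {t. 0 < frac (t - v k / 2 ^ m) \<and>
     frac (t - v k / 2 ^ m) < (if k = r then 2 else 1) / 2 ^ m}}"
    by (simp add: double_cell_def)
  also have "\<dots> \<in> sets haar"
  proof (rule sets_haar_cylinder)
    fix k
    have [measurable]: "(\<lambda>t::real. frac (t - c)) \<in> borel_measurable borel" for c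
      unfolding frac_def by measurable
    have "{t \<in> space borel. 0 < frac (t - c) \<and> frac (t - c) < l} \<in> sets borel" for c l :: real
      by measurable
    then show "{t. 0 < frac (t - v k / 2 ^ m) \<and>
        frac (t - v k / 2 ^ m) < (if k = r then 2 else 1) / 2 ^ m} \<in> sets borel"
      by (simp only: space_borel UNIV_I simp_thms)
  qed
  finally show ?thesis .
qed

text \<open>The bound adds the longest side, \<open>2 / 2 ^ m\<close>, and the tail
  \<open>1 / 2 ^ m\<close> from \<open>torus_dist_le\<close>. Measuring from the corner of
  \<open>v\<close> makes it valid across the wrap-around.\<close>

lemma torus_diameter_double_cell:
  assumes "2 \<le> m" "v \<in> grid m" "r < m"
  shows "0 \<le> torus_diameter (double_cell m v r)" "torus_diameter (double_cell m v r) \<le> 3 / 2 ^ m"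
proof -
  let ?B = "double_cell m v r"
  have ne: "?B \<noteq> {}"
  proof
    assume "?B = {}"
    then have "open_cell m v = {}"
      using double_cell_cells(1)[OF assms] by simp
    then show False
      using measure_cell(2)[OF assms(2)] by simp
  qed
  have sub: "?B \<subseteq> torus"
    by (auto simp: double_cell_def)
  have d: "0 \<le> torus_dist x y" "torus_dist x y \<le> 3 / 2 ^ m" if "x \<in> ?B" "y \<in> ?B" for x y
  proof -
    have t: "x \<in> torus" "y \<in> torus"
      using that sub by auto
    have "circle_dist (x k) (y k) \<le> 2 / 2 ^ m" if "k < m" for k
    proof -
      have "circle_dist (x k) (y k) \<le> \<bar>frac (x k - v k / 2 ^ m) - frac (y k - v k / 2 ^ m)\<bar>"
        using t by (intro circle_dist_frac_diff) (auto simp: torus_def PiE_iff)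
      moreover have "frac (x k - v k / 2 ^ m) \<le> 2 / 2 ^ m" "frac (y k - v k / 2 ^ m) \<le> 2 / 2 ^ m"
        using \<open>x \<in> ?B\<close> \<open>y \<in> ?B\<close> \<open>k < m\<close> divide_right_mono[of 1 2 "2 ^ m :: real"]
        by (fastforce simp: double_cell_def split: if_splits)+
      moreover have "0 \<le> frac (x k - v k / 2 ^ m)" "0 \<le> frac (y k - v k / 2 ^ m)"
        by simp_all
      ultimately show ?thesis
        by linarith
    qed
    from torus_dist_le[where m = m, OF t _ this]
    show "0 \<le> torus_dist x y" "torus_dist x y \<le> 3 / 2 ^ m"
      by simp_all
  qed
  show "0 \<le> torus_diameter ?B" "torus_diameter ?B \<le> 3 / 2 ^ m"
    using torus_diameter_bounds[OF ne sub d(2) d(1)] by auto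
qed

text \<open>
  Shifting coordinate \<open>r\<close> by one changes the weight by \<open>r\<close>, so every residue class can be
  moved to 0 by a single step: the code meets the closed neighbourhood of every cell.
\<close>

lemma double_cell_around:
  assumes "2 \<le> m" "m dvd 2 ^ m" "x \<in> torus"
  obtains B where "B \<in> basis_at extended_rdf_basis x" "B \<in> sets haar"
    "0 \<le> torus_diameter B" "torus_diameter B \<le> 3 / 2 ^ m"
    "0 < measure haar B" "measure haar B \<le> 2 * measure haar (B \<inter> code_set m)"
proof -
  obtain v where v: "v \<in> grid m" and x: "x \<in> cell m v"
    using torus_in_cell[OF assms(3)] .
  define s where "s = (\<Sum>i<m. i * v i) mod m"
  \<comment> \<open>The outer \<open>mod\<close> sends \<open>s = 0\<close> to direction 0, whose
    weight is 0; otherwise \<open>r = m - s\<close>.\<close>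
  define r where "r = (m - s) mod m"
  have s: "s < m" and r: "r < m"
    using assms(1) by (auto simp: s_def r_def)
  define w where "w = v(r := (v r + 1) mod 2 ^ m)"
  have "(s + r) mod m = 0"
    using s by (simp add: r_def mod_add_right_eq)
  then have "((\<Sum>i<m. i * v i) + r * 1) mod m = 0"
    by (simp add: s_def mod_add_left_eq)
  then have w: "w \<in> code m"
    using weight_shift[OF assms(2) r, of v 1] grid_shift[OF v r, of 1] unfolding w_def code_def
    by auto
  note cells = double_cell_cells[OF assms(1) v r, folded w_def]
  let ?B = "double_cell m v r"
  show thesis
  proof
    \<comment> \<open>The point may lie on the boundary of the box, which the definition of
      \<open>basis_at\<close> permits.\<close>
    have "x \<in> torus_topology closure_of ?B"
      using closure_of_open_cell[OF v x] closure_of_mono[OF cells(1)] by blast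
    then show "?B \<in> basis_at extended_rdf_basis x"
      using double_cell_in_basis[OF assms(1) v r] by (simp add: basis_at_def)
    show "0 \<le> torus_diameter ?B" "torus_diameter ?B \<le> 3 / 2 ^ m"
      using torus_diameter_double_cell[OF assms(1) v r] .
    have "measure haar (open_cell m v) \<le> measure haar ?B"
      using cells(1) by (intro haar.finite_measure_mono) auto
    then show "0 < measure haar ?B"
      using measure_cell(2)[OF v] by (smt (verit) zero_less_divide_1_iff zero_less_power)
    have wg: "w \<in> grid m"
      using w by (simp add: code_def)
    \<comment> \<open>Two cells of equal measure cover the box, and one of them belongs to the code:
      the code fills at least half.\<close>
    have "measure haar ?B \<le> measure haar (cell m v \<union> cell m w)"
      using cells(3) by (intro haar.finite_measure_mono) auto
    also have "\<dots> \<le> measure haar (cell m v) + measure haar (cell m w)"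
      by (intro measure_Un_le) auto
    also have "\<dots> = 2 * measure haar (open_cell m w)"
      using measure_cell[OF v] measure_cell[OF wg] by simp
    also have "measure haar (open_cell m w) \<le> measure haar (?B \<inter> code_set m)"
    proof (rule haar.finite_measure_mono)
      show "open_cell m w \<subseteq> ?B \<inter> code_set m"
        using cells(2) w open_cell_subset_cell[of m w] unfolding code_set_def by blast
    qed (intro sets.Int sets_double_cell sets_code_set)
    finally show "measure haar ?B \<le> 2 * measure haar (?B \<inter> code_set m)"
      by simp
  qed simp
qed

section \<open>Failure of differentiation\<close>

theorem theorem20:
  shows "\<not> differentiates_L_infinity extended_rdf_basis"
proof
  \<comment> \<open>Powers of 2 satisfy the divisibility condition, and starting at 4 makes the
    bounds 1/4 + 1/8 + ... add up to 1/2, less than full measure.\<close>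
  define M where "M = (\<lambda>k::nat. 2 ^ (k + 2) :: nat)"
  have M: "2 \<le> M k" "M k dvd 2 ^ M k" "k \<le> M k" for k
  proof -
    have "(2::nat) ^ 1 \<le> 2 ^ (k + 2)"
      by (intro power_increasing) auto
    then show "2 \<le> M k"
      by (simp add: M_def)
    \<comment> \<open>Divisibility between powers of 2 is a comparison of exponents, here
      \<open>k + 2\<close> and \<open>M k\<close>.\<close>
    have "k + 2 < 2 ^ (k + 2)"
      by (rule less_exp)
    then have "k + 2 \<le> M k"
      by (simp only: M_def less_imp_le)
    then show "M k dvd 2 ^ M k" "k \<le> M k"
      unfolding M_def by (intro le_imp_power_dvd, simp_all)
  qed
  define E where "E = (\<Union>k. code_set (M k))"
  have E [measurable]: "E \<in> sets haar"
    by (auto simp: E_def)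
  have half: "(\<lambda>k. 1 / real (M k)) sums (1 / 2)"
    using sums_mult[OF power_half_series, of "1 / 2"] by (simp add: M_def power_divide)
  have "measure haar E \<le> (\<Sum>k. measure haar (code_set (M k)))"
    unfolding E_def
    by (intro haar.finite_measure_subadditive_countably summable_comparison_test'[OF sums_summable[OF half]])
      (use measure_code_set_le M in auto)
  also have "\<dots> \<le> (\<Sum>k. 1 / real (M k))"
    by (intro suminf_le measure_code_set_le M sums_summable[OF half]
        summable_comparison_test'[OF sums_summable[OF half]])
      (use measure_code_set_le M in auto)
  also have "\<dots> = 1 / 2"
    using half by (simp add: sums_iff)
  finally have E_le: "measure haar E \<le> 1 / 2" .

  let ?f = "indicator E :: (nat \<Rightarrow> real) \<Rightarrow> real"
  have upper: "ereal (1 / 2) \<le> upper_derivative extended_rdf_basis ?f x" if x: "x \<in> torus" for x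
  proof -
    have "\<exists>B. B \<in> basis_at extended_rdf_basis x \<and> B \<in> sets haar \<and>
        0 \<le> torus_diameter B \<and> torus_diameter B \<le> 3 / 2 ^ M k \<and>
        0 < measure haar B \<and> measure haar B \<le> 2 * measure haar (B \<inter> code_set (M k))" for k
      using double_cell_around[OF M(1,2) x] by metis
    then obtain B where B: "\<And>k. B k \<in> basis_at extended_rdf_basis x" "\<And>k. B k \<in> sets haar"
      "\<And>k. 0 \<le> torus_diameter (B k)" "\<And>k. torus_diameter (B k) \<le> 3 / 2 ^ M k"
      "\<And>k. 0 < measure haar (B k)"
      "\<And>k. measure haar (B k) \<le> 2 * measure haar (B k \<inter> code_set (M k))"
      by metis
    have "(\<lambda>k. torus_diameter (B k)) \<longlonglongrightarrow> 0"
    proof (rule tendsto_sandwich[where f = "\<lambda>_. 0"])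
      show "\<forall>\<^sub>F k in sequentially. torus_diameter (B k) \<le> 3 * (1 / 2) ^ k"
      proof (intro always_eventually allI)
        fix k
        \<comment> \<open>A geometric bound in \<open>k\<close> is enough for the diameters to
          shrink to 0.\<close>
        have "(3::real) / 2 ^ M k \<le> 3 / 2 ^ k"
          using M(3)[of k] by (intro divide_left_mono power_increasing) auto
        then show "torus_diameter (B k) \<le> 3 * (1 / 2) ^ k"
          using B(4)[of k] by (simp add: power_divide)
      qed
      show "(\<lambda>k. 3 * (1 / 2) ^ k :: real) \<longlonglongrightarrow> 0"
        by (intro tendsto_mult_right_zero LIMSEQ_power_zero) simp
    qed (use B(3) in auto)
    then have contr: "contracts_to extended_rdf_basis B x"
      using B(1) by (simp add: contracts_to_def)
    have avg: "1 / 2 \<le> average ?f (B k)" for k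
    proof -
      have "(LINT x:B k|haar. ?f x) = measure haar (B k \<inter> E)"
        using B(2)[of k] E
        by (simp add: set_lebesgue_integral_def indicator_inter_arith[symmetric])
      \<comment> \<open>\<open>E\<close> contains the \<open>k\<close>-th code set, so it inherits
        the share of at least one half of \<open>B k\<close>.\<close>
      moreover have "measure haar (B k \<inter> code_set (M k)) \<le> measure haar (B k \<inter> E)"
        using B(2)[of k] E by (intro haar.finite_measure_mono) (auto simp: E_def)
      then have "measure haar (B k) \<le> 2 * measure haar (B k \<inter> E)"
        using B(6)[of k] by linarith
      ultimately show ?thesis
        using B(5)[of k] by (simp add: average_def field_simps)
    qed
    have "ereal (1 / 2) \<le> limsup (\<lambda>k. ereal (average ?f (B k)))"
      by (rule le_Limsup) (simp_all only: sequentially_bot not_False_eq_True ereal_less_eq avg eventually_True)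
    also have "\<dots> \<le> upper_derivative extended_rdf_basis ?f x"
      unfolding upper_derivative_def using contr by (intro SUP_upper) auto
    finally show ?thesis .
  qed

  assume diff: "differentiates_L_infinity extended_rdf_basis"
  have "?f \<in> L_infinity"
    by (auto simp: L_infinity_def indicator_def intro!: exI[of _ 1])
  then have "AE x in haar. upper_derivative extended_rdf_basis ?f x = ereal (?f x)"
    using diff unfolding differentiates_L_infinity_def by fastforce
  moreover have "AE x in haar. x \<in> torus"
    using AE_space[of haar] by (simp add: space_haar)
  \<comment> \<open>Differentiation would force the indicator to be at least 1/2, hence 1, almost
    everywhere; \<open>E\<close> would have full measure.\<close>
  ultimately have "AE x in haar. x \<in> E"
  proof eventually_elim
    case (elim x)
    then have "ereal (1 / 2) \<le> ereal (?f x)"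
      using upper[of x] by simp
    then show ?case
      by (cases "x \<in> E") simp_all
  qed
  then have "measure haar E = 1"
    using E by (simp add: haar.prob_eq_1)
  then show False
    using E_le by simp
qed

end
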